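(* Consider a LASSO (respectively CLASSO) problem and the corresponding LCA system $\dot{\mathbf{u}}=\mathbf{F}(\mathbf{u})$. Let $E^*=E(\mathbf{a}^* )$, $\mathbf{a}^*\in\mathcal{C}$, be the optimal objective function value of the problem. Let $\mathbf{u}(t)=\mathbf{U}(t,\mathbf{u}^{(0)})$ be the LCA flow with an arbitrary starting point $\mathbf{u}^{(0)}\in\mathbb{R}^N$. Then $\lim_{t\to\infty}V(\mathbf{u}(t))=E^*$.
   Context: Data: $\mathbf{s}\in\mathbb{R}^M$, a real number $\lambda>0$, and a matrix $\Phi=[\boldsymbol\phi_1,\ldots,\boldsymbol\phi_N]\in\mathbb{R}^{M\times N}$ whose columns have unit Euclidean norm. Put $E(\mathbf{a})=\frac12\|\mathbf{s}-\Phi\mathbf{a}\|_2^2+\lambda\|\mathbf{a}\|_1$ for $\mathbf{a}\in\mathbb{R}^N$. LASSO is the problem of minimizing $E$ over $\mathbb{R}^N$; CLASSO is the problem of minimizing $E$ over $\{\mathbf{a}\in\mathbb{R}^N\mid a_n\ge 0 \text{ for all } n\}$. $\mathcal{C}$ denotes the set of optimal solutions of the problem considered. Activation function: let $T_\lambda(x)=x-\lambda$ for $x>\lambda$ and $T_\lambda(x)=0$ for $x\le\lambda$; let $T_{\pm\lambda}(x)=T_\lambda(x)-T_\lambda(-x)$. Set $T=T_{\pm\lambda}$ for LASSO and $T=T_\lambda$ for CLASSO, and let $\mathbf{T}:\mathbb{R}^N\to\mathbb{R}^N$ apply $T$ to each component. LCA is the dynamical system $\dot{\mathbf{u}}=\mathbf{F}(\mathbf{u})$,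 $\mathbf{F}(\mathbf{u})=\mathbf{b}-\mathbf{u}-(\Phi^T\Phi-I)\mathbf{T}(\mathbf{u})$, $\mathbf{b}=\Phi^T\mathbf{s}$. Its solution for $t\ge0$ with initial position $\mathbf{u}^{(0)}$ is the flow $\mathbf{U}(t,\mathbf{u}^{(0)})$. The function $V:\mathbb{R}^N\to\mathbb{R}$ is $V(\mathbf{u})=E(\mathbf{T}(\mathbf{u}))$. *)

theory Defs
  imports "HOL-Analysis.Analysis"
begin

datatype problem = LASSO | CLASSO

definition l1_norm :: "real ^ 'n \<Rightarrow> real" where
  "l1_norm a = (\<Sum>n\<in>UNIV. \<bar>a $ n\<bar>)"

definition objective :: "real ^ 'n ^ 'm \<Rightarrow> real ^ 'm \<Rightarrow> real \<Rightarrow> real ^ 'n \<Rightarrow> real" where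
  "objective \<Phi> s lam a = (norm (s - \<Phi> *v a))\<^sup>2 / 2 + lam * l1_norm a"

fun feasible :: "problem \<Rightarrow> (real ^ 'n) set" where
  "feasible LASSO = UNIV"
| "feasible CLASSO = {a. \<forall>n. 0 \<le> a $ n}"

definition optimal_solutions ::
    "problem \<Rightarrow> real ^ 'n ^ 'm \<Rightarrow> real ^ 'm \<Rightarrow> real \<Rightarrow> (real ^ 'n) set" where
  "optimal_solutions p \<Phi> s lam =
     {a \<in> feasible p. \<forall>a' \<in> feasible p. objective \<Phi> s lam a \<le> objective \<Phi> s lam a'}"

definition threshold :: "real \<Rightarrow> real \<Rightarrow> real" where
  "threshold lam x = (if x > lam then x - lam else 0)"

fun activation :: "problem \<Rightarrow> real \<Rightarrow> real \<Rightarrow> real" where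
  "activation LASSO lam x = threshold lam x - threshold lam (- x)"
| "activation CLASSO lam x = threshold lam x"

definition activation_vec :: "problem \<Rightarrow> real \<Rightarrow> real ^ 'n \<Rightarrow> real ^ 'n" where
  "activation_vec p lam u = (\<chi> n. activation p lam (u $ n))"

definition lca_field ::
    "problem \<Rightarrow> real ^ 'n ^ 'm \<Rightarrow> real ^ 'm \<Rightarrow> real \<Rightarrow> real ^ 'n \<Rightarrow> real ^ 'n" where
  "lca_field p \<Phi> s lam u =
     transpose \<Phi> *v s - u - (transpose \<Phi> ** \<Phi> - mat 1) *v activation_vec p lam u"

text \<open>Only the values of \<open>u\<close> on \<open>[0, \<infinity>)\<close> matter; the derivative at \<open>0\<close> is one-sided.\<close>

definition forward_solution :: "('a::real_normed_vector \<Rightarrow> 'a) \<Rightarrow> 'a \<Rightarrow> (real \<Rightarrow> 'a) \<Rightarrow> bool" where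
  "forward_solution F x0 u \<longleftrightarrow>
     u 0 = x0 \<and> (\<forall>t\<ge>0. (u has_vector_derivative F (u t)) (at t within {0..}))"

text \<open>The description is well defined for \<open>t \<ge> 0\<close> when \<open>F\<close> is Lipschitz; see \<open>lca_flow_unique\<close> and
  \<open>lca_flow_solution\<close> below.\<close>

definition lca_flow ::
    "problem \<Rightarrow> real ^ 'n ^ 'm \<Rightarrow> real ^ 'm \<Rightarrow> real \<Rightarrow> real \<Rightarrow> real ^ 'n \<Rightarrow> real ^ 'n" where
  "lca_flow p \<Phi> s lam t u0 =
     (THE x. \<exists>u. forward_solution (lca_field p \<Phi> s lam) u0 u \<and> x = u t)"

definition lyapunov :: "problem \<Rightarrow> real ^ 'n ^ 'm \<Rightarrow> real ^ 'm \<Rightarrow> real \<Rightarrow> real ^ 'n \<Rightarrow> real" where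
  "lyapunov p \<Phi> s lam u = objective \<Phi> s lam (activation_vec p lam u)"


lemma forward_solution_unique:
  fixes F :: "'a::euclidean_space \<Rightarrow> 'a"
  assumes lip: "L-lipschitz_on UNIV F"
    and u: "forward_solution F x0 u" and v: "forward_solution F x0 v" and t: "t \<ge> 0"
  shows "u t = v t"
proof -
  define w where "w = (\<lambda>t. exp (- 2 * L * t) * ((u t - v t) \<bullet> (u t - v t)))"
  have du: "(u has_vector_derivative F (u r)) (at r within {0..})"
    and dv: "(v has_vector_derivative F (v r)) (at r within {0..})" if "r \<ge> 0" for r
    using u v that by (auto simp: forward_solution_def)
  define w' where "w' = (\<lambda>r. exp (- 2 * L * r) *
        (2 * ((u r - v r) \<bullet> (F (u r) - F (v r))) - 2 * L * ((u r - v r) \<bullet> (u r - v r))))"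
  have dw: "(w has_real_derivative w' r) (at r within {0..t})" if "r \<in> {0..t}" for r
  proof -
    have "r \<ge> 0" using that by simp
    have d: "((\<lambda>r. u r - v r) has_derivative (\<lambda>h. h *\<^sub>R (F (u r) - F (v r)))) (at r within {0..t})"
      using has_vector_derivative_diff[OF du[OF \<open>r \<ge> 0\<close>] dv[OF \<open>r \<ge> 0\<close>]]
      unfolding has_vector_derivative_def
      by (rule has_derivative_subset) auto
    show ?thesis
      unfolding has_field_derivative_def w_def w'_def
      by (rule derivative_eq_intros d refl)+ (auto simp: fun_eq_iff algebra_simps inner_commute)
  qed
  have w'_le: "w' r \<le> 0" for r
  proof -
    have "(u r - v r) \<bullet> (F (u r) - F (v r)) \<le> norm (u r - v r) * norm (F (u r) - F (v r))"
      by (rule norm_cauchy_schwarz)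
    also have "\<dots> \<le> norm (u r - v r) * (L * norm (u r - v r))"
      using lipschitz_onD[OF lip, of "u r" "v r"] by (intro mult_left_mono) (auto simp: dist_norm)
    also have "\<dots> = L * ((u r - v r) \<bullet> (u r - v r))"
      by (simp add: power2_norm_eq_inner[symmetric] power2_eq_square)
    finally show ?thesis unfolding w'_def by (simp add: mult_le_0_iff)
  qed
  have "w t \<le> w 0"
  proof (rule DERIV_nonpos_imp_decreasing_open[OF t])
    fix r assume r: "0 < r" "r < t"
    then have "(w has_real_derivative w' r) (at r)"
      using dw[of r] by (simp add: at_within_Icc_at)
    then show "\<exists>y. (w has_real_derivative y) (at r) \<and> y \<le> 0" using w'_le by blast
  next
    show "continuous_on {0..t} w" using dw by (rule DERIV_continuous_on)
  qed
  also have "w 0 = 0" using u v by (simp add: w_def forward_solution_def)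
  finally have "(u t - v t) \<bullet> (u t - v t) \<le> 0"
    unfolding w_def by (simp add: mult_le_0_iff)
  then show ?thesis by (metis inner_ge_zero inner_eq_zero_iff antisym eq_iff_diff_eq_0)
qed

text \<open>Global existence, by Banach's fixed point theorem applied to \<open>t \<mapsto> exp (- c * t) *\<^sub>R u t\<close> for
  a large \<open>c\<close>.\<close>

lemma forward_solution_exists:
  fixes F :: "'a::euclidean_space \<Rightarrow> 'a"
  assumes lip: "L-lipschitz_on UNIV F"
  shows "\<exists>u. forward_solution F x0 u"
proof -
  have L: "L \<ge> 0" using lip by (rule lipschitz_on_nonneg)
  define c where "c = 2 * L + 1"
  have c: "c > 0" "2 * L \<le> c" using L by (auto simp: c_def)
  have contF: "continuous_on A F" for A
    using lipschitz_on_continuous_on[OF lip] continuous_on_subset by blast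
  define I where "I = (\<lambda>(g :: real \<Rightarrow>\<^sub>C 'a) t. integral {0..t} (\<lambda>r. F (exp (c * r) *\<^sub>R g r)))"
  have contG: "continuous_on A (\<lambda>r. F (exp (c * r) *\<^sub>R apply_bcontfun g r))" for g A
    by (rule continuous_on_compose2[OF contF]) (auto intro!: continuous_intros)
  have intG: "(\<lambda>r. F (exp (c * r) *\<^sub>R apply_bcontfun g r)) integrable_on {0..t}" for g t
    by (rule integrable_continuous_real[OF contG])
  have expint: "((\<lambda>r. B * exp (c * r)) has_integral B * (exp (c * t) - 1) / c) {0..t}"
    if "t \<ge> 0" for B t
  proof -
    have "((\<lambda>r. B * exp (c * r)) has_integral B * exp (c * t) / c - B * exp (c * 0) / c) {0..t}"
      using that c
      by (intro fundamental_theorem_of_calculus)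
         (auto intro!: derivative_eq_intros simp flip: has_real_derivative_iff_has_vector_derivative)
    then show ?thesis by (simp add: algebra_simps diff_divide_distrib)
  qed
  have contI: "continuous_on {0..} (I g)" for g
    unfolding continuous_on_eq_continuous_within
  proof
    fix t :: real assume "t \<in> {0..}"
    then have "(I g has_vector_derivative F (exp (c * t) *\<^sub>R g t)) (at t within {0..t+1})"
      unfolding I_def by (intro integral_has_vector_derivative contG) auto
    then have "continuous (at t within {0..t+1}) (I g)"
      by (rule has_vector_derivative_continuous)
    moreover have "at t within {0..t+1} = at t within {0..}"
      by (rule at_within_nhd[of _ "{..<t+1}"]) auto
    ultimately show "continuous (at t within {0..}) (I g)" by simp
  qed
  define K where "K = (\<lambda>g t. exp (- c * max 0 t) *\<^sub>R (x0 + I g (max 0 t)))"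
  have cont_K: "continuous_on UNIV (K g)" for g
    unfolding K_def
    by (intro continuous_intros continuous_on_compose2[OF contI]) auto
  have K_bc: "K g \<in> bcontfun" for g
  proof -
    define B where "B = norm (F 0) + L * norm g"
    have B: "B \<ge> 0" using L by (simp add: B_def)
    have "norm (K g t) \<le> norm x0 + B / c" for t
    proof -
      define q where "q = max 0 t"
      have q: "q \<ge> 0" by (simp add: q_def)
      have "norm (F (exp (c * r) *\<^sub>R g r)) \<le> B * exp (c * r)" if "r \<in> {0..q}" for r
      proof -
        have "norm (F (exp (c * r) *\<^sub>R g r)) \<le> norm (F 0) + norm (F (exp (c * r) *\<^sub>R g r) - F 0)"
          by norm
        also have "norm (F (exp (c * r) *\<^sub>R g r) - F 0) \<le> L * (exp (c * r) * norm (g r))"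
          using lipschitz_onD[OF lip, of "exp (c * r) *\<^sub>R g r" 0] by (simp add: dist_norm)
        also have "\<dots> \<le> L * (exp (c * r) * norm g)"
          using L by (intro mult_left_mono norm_bounded) auto
        also have "norm (F 0) \<le> norm (F 0) * exp (c * r)"
          using that c by (simp add: mult_le_cancel_left1)
        finally show ?thesis by (simp add: B_def algebra_simps)
      qed
      then have "norm (I g q) \<le> integral {0..q} (\<lambda>r. B * exp (c * r))"
        unfolding I_def
        by (intro integral_norm_bound_integral intG has_integral_integrable[OF expint[OF q]]) auto
      also have "\<dots> = B * (exp (c * q) - 1) / c" using expint[OF q] by (rule integral_unique)
      also have "\<dots> \<le> B / c * exp (c * q)" using B c by (simp add: field_simps)
      finally have "norm (I g q) \<le> B / c * exp (c * q)" .
      then have I: "exp (- c * q) * norm (I g q) \<le> B / c"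
        by (simp add: exp_minus field_simps)
      have "norm (K g t) \<le> exp (- c * q) * norm x0 + exp (- c * q) * norm (I g q)"
        unfolding K_def q_def[symmetric]
        by (simp add: distrib_left[symmetric] norm_triangle_ineq)
      also have "exp (- c * q) * norm x0 \<le> norm x0"
        using q c by (intro mult_left_le_one_le) auto
      finally show ?thesis using I by simp
    qed
    then show ?thesis using cont_K by (auto simp: bcontfun_def bounded_iff)
  qed
  define KK where "KK = (\<lambda>g. Bcontfun (K g))"
  have KK: "apply_bcontfun (KK g) = K g" for g
    unfolding KK_def using K_bc by (rule Bcontfun_inverse)
  have contr: "dist (KK g) (KK h) \<le> 1/2 * dist g h" for g h
  proof (rule dist_bound)
    fix t :: real
    define q where "q = max 0 t"
    have q: "q \<ge> 0" by (simp add: q_def)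
    define B where "B = L * dist g h"
    have B: "B \<ge> 0" using L by (simp add: B_def)
    have bd: "norm (F (exp (c * r) *\<^sub>R g r) - F (exp (c * r) *\<^sub>R h r)) \<le> B * exp (c * r)" for r
    proof -
      have "norm (F (exp (c * r) *\<^sub>R g r) - F (exp (c * r) *\<^sub>R h r))
          \<le> L * (exp (c * r) * dist (g r) (h r))"
        using lipschitz_onD[OF lip, of "exp (c * r) *\<^sub>R g r" "exp (c * r) *\<^sub>R h r"]
        by (simp add: dist_norm flip: scaleR_diff_right)
      also have "\<dots> \<le> L * (exp (c * r) * dist g h)"
        using L by (intro mult_left_mono dist_bounded) auto
      finally show ?thesis by (simp add: B_def algebra_simps)
    qed
    have "I g q - I h q =
        integral {0..q} (\<lambda>r. F (exp (c * r) *\<^sub>R g r) - F (exp (c * r) *\<^sub>R h r))"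
      unfolding I_def by (rule integral_diff[symmetric]) (rule intG)+
    also have "norm \<dots> \<le> integral {0..q} (\<lambda>r. B * exp (c * r))"
      by (intro integral_norm_bound_integral integrable_diff intG
            has_integral_integrable[OF expint[OF q]] bd)
    also have "\<dots> = B * (exp (c * q) - 1) / c" using expint[OF q] by (rule integral_unique)
    also have "\<dots> \<le> B / c * exp (c * q)" using B c by (simp add: field_simps)
    finally have I: "exp (- c * q) * norm (I g q - I h q) \<le> B / c"
      by (simp add: exp_minus field_simps)
    have "dist (K g t) (K h t) = exp (- c * q) * norm (I g q - I h q)"
      unfolding K_def q_def[symmetric] dist_norm by (simp flip: scaleR_diff_right)
    also have "\<dots> \<le> B / c" by (rule I)
    also have "\<dots> \<le> 1/2 * dist g h"
    proof -
      have "2 * L * dist g h \<le> c * dist g h" using c by (intro mult_right_mono) auto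
      then show ?thesis using c by (simp add: B_def field_simps)
    qed
    finally show "dist (KK g t) (KK h t) \<le> 1/2 * dist g h" by (simp add: KK)
  qed
  obtain g where g: "KK g = g"
    using banach_fix_type[of "1/2" KK] contr by auto
  define u where "u = (\<lambda>t. exp (c * t) *\<^sub>R g t)"
  have u_eq: "u t = x0 + I g t" if "t \<ge> 0" for t
  proof -
    have "apply_bcontfun g t = K g t" using KK[of g] g by simp
    then show ?thesis using that
      by (simp add: u_def K_def max_absorb2 flip: exp_add)
  qed
  have "(u has_vector_derivative F (u t)) (at t within {0..})" if t: "t \<ge> 0" for t
  proof -
    have "(I g has_vector_derivative F (u t)) (at t within {0..t+1})"
      unfolding I_def u_def using t by (intro integral_has_vector_derivative contG) auto
    moreover have "at t within {0..t+1} = at t within {0..}"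
      by (rule at_within_nhd[of _ "{..<t+1}"]) auto
    ultimately have "((\<lambda>t. x0 + I g t) has_vector_derivative F (u t)) (at t within {0..})"
      by (auto intro!: derivative_eq_intros)
    then show ?thesis
      by (rule has_vector_derivative_transform[rotated 2]) (use t u_eq in auto)
  qed
  moreover have "u 0 = x0" using u_eq[of 0] by (simp add: I_def)
  ultimately show ?thesis unfolding forward_solution_def by blast
qed

lemma activation_lipschitz:
  assumes "lam > 0"
  shows "\<bar>activation p lam x - activation p lam y\<bar> \<le> \<bar>x - y\<bar>"
  using assms by (cases p) (auto simp: threshold_def)

lemma activation_vec_lipschitz:
  assumes "lam > 0"
  shows "norm (activation_vec p lam u - activation_vec p lam v) \<le> norm (u - v)"
  using assms by (auto simp: norm_le_componentwise_cart activation_vec_def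
      intro!: norm_le_componentwise_cart activation_lipschitz)

lemma lca_field_lipschitz:
  fixes \<Phi> :: "real ^ 'n ^ 'm"
  assumes "lam > 0"
  shows "\<exists>L. L-lipschitz_on UNIV (lca_field p \<Phi> s lam)"
proof -
  define A where "A = transpose \<Phi> ** \<Phi> - mat 1"
  have bl: "bounded_linear ((*v) A)" by simp
  define k where "k = onorm ((*v) A)"
  have k: "k \<ge> 0" unfolding k_def by (rule onorm_pos_le[OF bl])
  have "dist (lca_field p \<Phi> s lam u) (lca_field p \<Phi> s lam v) \<le> (1 + k) * dist u v" for u v
  proof -
    have "lca_field p \<Phi> s lam u - lca_field p \<Phi> s lam v
        = (v - u) - A *v (activation_vec p lam u - activation_vec p lam v)"
      by (simp add: lca_field_def A_def matrix_vector_mult_diff_distrib)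
    also have "norm \<dots> \<le> norm (v - u) + norm (A *v (activation_vec p lam u - activation_vec p lam v))"
      by (rule norm_triangle_ineq4)
    also have "norm (A *v (activation_vec p lam u - activation_vec p lam v))
        \<le> k * norm (activation_vec p lam u - activation_vec p lam v)"
      unfolding k_def by (rule onorm[OF bl])
    also have "\<dots> \<le> k * norm (u - v)"
      using k activation_vec_lipschitz[OF assms] by (intro mult_left_mono)
    finally show ?thesis by (simp add: dist_norm norm_minus_commute algebra_simps)
  qed
  then show ?thesis using k by (intro exI[of _ "1 + k"] lipschitz_onI) auto
qed

lemma lca_flow_unique:
  assumes "lam > 0" and u: "forward_solution (lca_field p \<Phi> s lam) u0 u" and t: "t \<ge> 0"
  shows "lca_flow p \<Phi> s lam t u0 = u t"
proof -
  obtain L where "L-lipschitz_on UNIV (lca_field p \<Phi> s lam)"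
    using lca_field_lipschitz[OF assms(1)] by blast
  then show ?thesis
    unfolding lca_flow_def using u t forward_solution_unique by (intro the_equality) blast+
qed

lemma lca_flow_solution:
  assumes "lam > 0"
  shows "forward_solution (lca_field p \<Phi> s lam) u0 (\<lambda>t. lca_flow p \<Phi> s lam t u0)"
proof -
  obtain u where u: "forward_solution (lca_field p \<Phi> s lam) u0 u"
    using lca_field_lipschitz[OF assms] forward_solution_exists by blast
  have eq: "lca_flow p \<Phi> s lam t u0 = u t" if "t \<ge> 0" for t
    using lca_flow_unique[OF assms u that] .
  show ?thesis
    unfolding forward_solution_def
  proof (intro conjI allI impI)
    show "lca_flow p \<Phi> s lam 0 u0 = u0" using eq[of 0] u by (simp add: forward_solution_def)
    fix t :: real assume t: "t \<ge> 0"
    then have "(u has_vector_derivative lca_field p \<Phi> s lam (lca_flow p \<Phi> s lam t u0)) (at t within {0..})"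
      using u eq by (simp add: forward_solution_def)
    then show "((\<lambda>t. lca_flow p \<Phi> s lam t u0) has_vector_derivative
        lca_field p \<Phi> s lam (lca_flow p \<Phi> s lam t u0)) (at t within {0..})"
      by (rule has_vector_derivative_transform[rotated 2]) (use t eq in auto)
  qed
qed

lemma optimal_solutions_nonempty:
  fixes \<Phi> :: "real ^ 'n ^ 'm"
  assumes "lam > 0"
  shows "optimal_solutions p \<Phi> s lam \<noteq> {}"
proof -
  let ?E = "objective \<Phi> s lam"
  define R where "R = ?E 0 / lam"
  have zero: "0 \<in> (feasible p :: (real ^ 'n) set)" by (cases p) auto
  have R: "R \<ge> 0" using assms by (simp add: R_def objective_def l1_norm_def)
  have far: "?E a > ?E 0" if "norm a > R" for a
  proof -
    have "?E 0 = lam * R" using assms by (simp add: R_def)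
    also have "\<dots> < lam * norm a" using that assms by simp
    also have "\<dots> \<le> lam * l1_norm a"
      using norm_le_l1_cart[of a] assms by (simp add: l1_norm_def)
    also have "\<dots> \<le> ?E a" by (simp add: objective_def)
    finally show ?thesis .
  qed
  have "closed (feasible p :: (real ^ 'n) set)"
  proof (cases p)
    case CLASSO
    then show ?thesis
      by (auto intro!: closed_Collect_all closed_Collect_le continuous_intros)
  qed auto
  then have "compact (cball 0 R \<inter> feasible p :: (real ^ 'n) set)"
    by (intro compact_Int_closed) auto
  moreover have "cball 0 R \<inter> feasible p \<noteq> ({} :: (real ^ 'n) set)"
  proof -
    have "0 \<in> cball 0 R \<inter> (feasible p :: (real ^ 'n) set)" using R zero by simp
    then show ?thesis by blast
  qed
  moreover have "continuous_on (cball 0 R \<inter> feasible p) ?E"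
    unfolding objective_def[abs_def] l1_norm_def
    by (intro continuous_intros linear_continuous_on_compose[OF continuous_on_id]) auto
  ultimately obtain a where a: "a \<in> cball 0 R \<inter> feasible p"
    and min: "\<And>b. b \<in> cball 0 R \<inter> feasible p \<Longrightarrow> ?E a \<le> ?E b"
    using continuous_attains_inf by metis
  have "?E a \<le> ?E b" if "b \<in> feasible p" for b
  proof (cases "norm b > R")
    case True
    have "?E a \<le> ?E 0" using min[of 0] R zero by simp
    then show ?thesis using far[OF True] by simp
  qed (use min that in simp)
  then show ?thesis using a by (auto simp: optimal_solutions_def)
qed

end

theory Submission
  imports Defs
begin

text \<open>
  Let \<open>a = T u\<close>. Everything rests on one observation: \<open>T\<close> is the proximal map of
  \<open>\<psi> = \<lambda> \<parallel>\<cdot>\<parallel>\<^sub>1\<close> (plus the indicator of the feasible set), so that \<open>u - a\<close> is a subgradient of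
  \<open>\<psi>\<close> at \<open>a\<close>. Since \<open>F u = \<Phi>\<^sup>T (s - \<Phi> a) - (u - a)\<close>, the vector \<open>- F u\<close> is then a subgradient of
  the convex energy \<open>E\<close>, restricted to the feasible set, at \<open>a\<close> (\<open>objective_subgradient\<close>):
  the system is a mirror descent, in which the dual variable \<open>u\<close> moves against a subgradient taken at the primal point \<open>T u\<close>.
  Two consequences give the limit, and even the rate \<open>V (u t) - E\<^sup>* = O(1/t)\<close>.

  \<^item> The energy does not increase (\<open>lyapunov_nonincreasing\<close>). Formally
    \<open>dV/dt = - F \<bullet> da/dt \<le> 0\<close>, because \<open>du/dt = F\<close> and \<open>T\<close> is monotone. As \<open>T\<close> has kinks, the
    derivative of \<open>a\<close> need not exist; instead, the subgradient inequality bounds the increment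
    of \<open>V\<close> over a time step \<open>h\<close> by a multiple of \<open>h\<^sup>2\<close>, and such increments add up to nothing
    under refinement (\<open>quadratic_increment_imp_le\<close>).

  \<^item> For feasible \<open>c\<close>, the convex function \<open>W u = \<parallel>T u\<parallel>\<^sup>2 / 2 - u \<bullet> c\<close> is bounded below and has
    gradient \<open>T u - c\<close>. Along the flow its derivative is \<open>F u \<bullet> (T u - c) \<le> E c - V u\<close>. As \<open>V\<close>
    is nonincreasing, integration up to time \<open>t\<close> yields \<open>t (V (u t) - E c) \<le> W (u 0) - inf W\<close>
    (\<open>lyapunov_gap_bound\<close>).

  For an optimal \<open>c\<close> the left side is nonnegative because \<open>T u\<close> is feasible, and division by
  \<open>t\<close> finishes the proof.
\<close>

section \<open>The activation function as a proximal map\<close>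

text \<open>The subgradient inequality for \<open>lam * \<bar>\<cdot>\<bar>\<close>, restricted to the half line for CLASSO, at the point
  \<open>T x\<close> with subgradient \<open>x - T x\<close>: this residual is \<open>\<plusminus> lam\<close> where \<open>T x\<close> is nonzero, and where
  \<open>T x = 0\<close> it is \<open>x\<close> itself, which belongs to \<open>[- lam, lam]\<close> or, for CLASSO, is at most \<open>lam\<close>.\<close>

lemma activation_prox:
  assumes "lam > 0" and "p = CLASSO \<Longrightarrow> 0 \<le> c"
  shows "(x - activation p lam x) * (c - activation p lam x)
    \<le> lam * \<bar>c\<bar> - lam * \<bar>activation p lam x\<bar>"
proof -
  define a where "a = activation p lam x"
  consider "x > lam" "a = x - lam" | "x < - lam" "p = LASSO" "a = x + lam"
    | "\<bar>x\<bar> \<le> lam" "a = 0" | "x \<le> lam" "p = CLASSO" "a = 0"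
    using assms(1) unfolding a_def by (cases p) (force simp: threshold_def)+
  then have "(x - a) * (c - a) \<le> lam * \<bar>c\<bar> - lam * \<bar>a\<bar>"
  proof cases
    case 1
    then have "lam * (c - a) \<le> lam * (\<bar>c\<bar> - \<bar>a\<bar>)"
      using assms(1) by (intro mult_left_mono) auto
    moreover have "x - a = lam" using 1 by simp
    ultimately show ?thesis by (simp add: right_diff_distrib)
  next
    case 2
    then have "lam * (a - c) \<le> lam * (\<bar>c\<bar> - \<bar>a\<bar>)"
      using assms(1) by (intro mult_left_mono) auto
    moreover have "x - a = - lam" using 2 by simp
    ultimately show ?thesis by (simp add: right_diff_distrib)
  next
    case 3
    have "x * c \<le> \<bar>x\<bar> * \<bar>c\<bar>" by (metis abs_ge_self abs_mult)
    also have "\<dots> \<le> lam * \<bar>c\<bar>" using 3 by (simp add: mult_right_mono)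
    finally show ?thesis using 3 by simp
  next
    case 4
    then show ?thesis using assms(2) by (simp add: mult_right_mono)
  qed
  then show ?thesis by (simp add: a_def)
qed

lemma activation_mono:
  assumes "lam > 0"
  shows "0 \<le> (x - y) * (activation p lam x - activation p lam y)"
  using assms by (cases p) (auto simp: threshold_def zero_le_mult_iff)

lemma activation_vec_mono:
  assumes "lam > 0"
  shows "0 \<le> (u - v) \<bullet> (activation_vec p lam u - activation_vec p lam v)"
  unfolding inner_vec_def activation_vec_def
  by (intro sum_nonneg) (simp add: activation_mono[OF assms])

lemma activation_vec_feasible: "lam > 0 \<Longrightarrow> activation_vec p lam u \<in> feasible p"
  by (cases p) (auto simp: activation_vec_def threshold_def)

lemma activation_vec_prox:
  assumes "lam > 0" and "c \<in> feasible p"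
  shows "(u - activation_vec p lam u) \<bullet> (c - activation_vec p lam u)
    \<le> lam * l1_norm c - lam * l1_norm (activation_vec p lam u)"
  unfolding inner_vec_def l1_norm_def sum_distrib_left sum_subtractf[symmetric]
  using assms by (intro sum_mono) (auto simp: activation_vec_def intro!: activation_prox)

text \<open>Convexity of the quadratic term gives the subgradient \<open>- \<Phi>\<^sup>T (s - \<Phi> a)\<close> at \<open>a = T u\<close>, the proximal
  property gives \<open>u - a\<close> for the penalty, and the field is minus the sum of the two.\<close>

lemma objective_subgradient:
  fixes \<Phi> :: "real ^ 'n ^ 'm"
  assumes "lam > 0" and "c \<in> feasible p"
  shows "lyapunov p \<Phi> s lam u + lca_field p \<Phi> s lam u \<bullet> (activation_vec p lam u - c)
    \<le> objective \<Phi> s lam c"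
proof -
  define a where "a = activation_vec p lam u"
  define r where "r = s - \<Phi> *v a"
  have F: "lca_field p \<Phi> s lam u = transpose \<Phi> *v r - (u - a)"
    by (simp add: lca_field_def r_def a_def algebra_simps matrix_vector_mult_diff_distrib
        matrix_vector_mult_diff_rdistrib matrix_vector_mul_assoc)
  have "s - \<Phi> *v c = r + \<Phi> *v (a - c)"
    by (simp add: r_def matrix_vector_mult_diff_distrib)
  then have "(norm (s - \<Phi> *v c))\<^sup>2 = (norm r)\<^sup>2 + 2 * (r \<bullet> (\<Phi> *v (a - c))) + (norm (\<Phi> *v (a - c)))\<^sup>2"
    by (simp add: power2_norm_eq_inner inner_add inner_commute)
  then have "(norm r)\<^sup>2 / 2 + r \<bullet> (\<Phi> *v (a - c)) \<le> (norm (s - \<Phi> *v c))\<^sup>2 / 2"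
    by simp
  moreover have "- ((u - a) \<bullet> (a - c)) \<le> lam * l1_norm c - lam * l1_norm a"
    using activation_vec_prox[OF assms, of u] by (simp add: a_def inner_diff_right)
  ultimately show ?thesis
    unfolding lyapunov_def objective_def F a_def[symmetric] r_def[symmetric]
    by (simp add: inner_diff_left dot_lmul_matrix)
qed

section \<open>The energy does not increase along the flow\<close>

text \<open>A replacement for the sign of a derivative when the function is not known to be
  differentiable: over \<open>n\<close> equal steps the increments sum to at most \<open>C * (b - a)\<^sup>2 / n\<close>.\<close>

lemma quadratic_increment_imp_le:
  fixes f :: "real \<Rightarrow> real"
  assumes "a \<le> b"
    and incr: "\<And>x y. \<lbrakk>a \<le> x; x \<le> y; y \<le> b\<rbrakk> \<Longrightarrow> f y - f x \<le> C * (y - x)\<^sup>2"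
  shows "f b \<le> f a"
proof -
  have step: "f b - f a \<le> C * (b - a)\<^sup>2 / real (Suc m)" for m
  proof -
    define n where "n = Suc m"
    define z where "z i = a + real i * ((b - a) / real n)" for i
    have n: "real n > 0" by (simp add: n_def)
    have zs: "z (Suc i) - z i = (b - a) / real n" for i
      unfolding z_def of_nat_Suc distrib_right by simp
    have z0: "z 0 = a" and zn: "z n = b" using n by (auto simp: z_def)
    have mono: "mono z" using zs assms(1) n
      by (intro mono_iff_le_Suc[THEN iffD2] allI) (metis diff_ge_0_iff_ge divide_nonneg_pos)
    have "f b - f a = (\<Sum>i<n. f (z (Suc i)) - f (z i))"
      by (simp add: sum_lessThan_telescope[of "\<lambda>i. f (z i)"] z0 zn)
    also have "\<dots> \<le> (\<Sum>i<n. C * ((b - a) / real n)\<^sup>2)"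
    proof (rule sum_mono)
      fix i assume "i \<in> {..<n}"
      then have "a \<le> z i" "z i \<le> z (Suc i)" "z (Suc i) \<le> b"
        using monoD[OF mono, of 0 i] monoD[OF mono, of i "Suc i"] monoD[OF mono, of "Suc i" n]
        by (auto simp: z0 zn)
      from incr[OF this] show "f (z (Suc i)) - f (z i) \<le> C * ((b - a) / real n)\<^sup>2"
        by (simp add: zs)
    qed
    also have "\<dots> = C * (b - a)\<^sup>2 / real n" using n by (simp add: power2_eq_square)
    finally show ?thesis by (simp add: n_def)
  qed
  have "(\<lambda>m. C * (b - a)\<^sup>2 * inverse (real (Suc m))) \<longlonglongrightarrow> C * (b - a)\<^sup>2 * 0"
    by (intro tendsto_intros LIMSEQ_inverse_real_of_nat)
  then have "f b - f a \<le> C * (b - a)\<^sup>2 * 0"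
    by (rule LIMSEQ_le_const) (use step in \<open>auto simp: divide_inverse\<close>)
  then show ?thesis by simp
qed

lemma forward_solution_at:
  assumes "forward_solution F x0 u" and "0 < t"
  shows "(u has_vector_derivative F (u t)) (at t)"
proof -
  have "(u has_vector_derivative F (u t)) (at t within {0..})"
    using assms by (simp add: forward_solution_def)
  moreover have "at t within {0..} = at t"
    using assms(2) by (intro at_within_interior) simp
  ultimately show ?thesis by simp
qed

lemma forward_solution_continuous:
  assumes "forward_solution F x0 u"
  shows "continuous_on {0..} u"
  using assms unfolding forward_solution_def continuous_on_eq_continuous_within
  by (auto intro: has_vector_derivative_continuous)

text \<open>The mean value theorem fails for vector-valued functions, but it holds for the component in
  any fixed direction.\<close>

lemma forward_solution_mean_value:
  fixes d :: "'a::euclidean_space"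
  assumes u: "forward_solution F x0 u" and xy: "0 \<le> x" "x < y"
  obtains z where "x < z" "z < y" "(u y - u x) \<bullet> d = (y - x) * (F (u z) \<bullet> d)"
proof -
  have "continuous_on {x..y} (\<lambda>r. u r \<bullet> d)"
    using xy by (intro continuous_intros continuous_on_subset[OF forward_solution_continuous[OF u]]) auto
  moreover have "((\<lambda>r. u r \<bullet> d) has_derivative (\<lambda>h. h * (F (u z) \<bullet> d))) (at z)"
    if "x < z" "z < y" for z
  proof -
    have "(u has_derivative (\<lambda>h. h *\<^sub>R F (u z))) (at z)"
      using forward_solution_at[OF u, of z] xy that by (simp add: has_vector_derivative_def)
    then show ?thesis by (auto intro!: derivative_eq_intros)
  qed
  ultimately obtain z where "x < z" "z < y" "u y \<bullet> d - u x \<bullet> d = (y - x) * (F (u z) \<bullet> d)"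
    using mvt[OF xy(2), of "\<lambda>r. u r \<bullet> d" "\<lambda>z h. h * (F (u z) \<bullet> d)"] by blast
  then show ?thesis using that by (simp add: inner_diff_left)
qed

lemma forward_solution_lipschitz_on_interval:
  fixes F :: "'a::euclidean_space \<Rightarrow> 'a"
  assumes u: "forward_solution F x0 u" and F: "continuous_on UNIV F"
  obtains B where "B \<ge> 0" and "\<And>x y. \<lbrakk>0 \<le> x; x \<le> y; y \<le> b\<rbrakk> \<Longrightarrow> norm (u y - u x) \<le> B * (y - x)"
proof -
  have "continuous_on {0..b} (\<lambda>t. F (u t))"
    by (rule continuous_on_compose2[OF F continuous_on_subset[OF forward_solution_continuous[OF u]]]) auto
  then have "bounded ((\<lambda>t. F (u t)) ` {0..b})"
    by (intro compact_imp_bounded compact_continuous_image) auto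
  then obtain B where B: "B > 0" "\<And>t. t \<in> {0..b} \<Longrightarrow> norm (F (u t)) \<le> B"
    unfolding bounded_pos by auto
  have "norm (u y - u x) \<le> B * (y - x)" if xy: "0 \<le> x" "x \<le> y" "y \<le> b" for x y
  proof (cases "x < y \<and> u y \<noteq> u x")
    case True
    define d where "d = u y - u x"
    obtain z where z: "x < z" "z < y" "d \<bullet> d = (y - x) * (F (u z) \<bullet> d)"
      using forward_solution_mean_value[OF u xy(1), of y d] True unfolding d_def by blast
    have "F (u z) \<bullet> d \<le> B * norm d"
      using norm_cauchy_schwarz[of "F (u z)" d] mult_right_mono[OF B(2)[of z] norm_ge_zero[of d]] z xy
      by auto
    then have "norm d * norm d \<le> (B * (y - x)) * norm d"
      using z xy mult_left_mono[of "F (u z) \<bullet> d" "B * norm d" "y - x"]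
      by (simp add: algebra_simps flip: power2_norm_eq_inner power2_eq_square)
    then show ?thesis using True by (simp add: d_def)
  qed (use xy B in auto)
  then show ?thesis using that[of B] B by simp
qed

text \<open>Over a step from \<open>x\<close> to \<open>y\<close> put \<open>d = T (u y) - T (u x)\<close>. The subgradient inequality at the
  later point bounds the increment of the energy by \<open>- F (u y) \<bullet> d\<close>. Monotonicity of \<open>T\<close> says
  \<open>F (u z) \<bullet> d \<ge> 0\<close> at some intermediate time \<open>z\<close>, and exchanging \<open>u z\<close> for \<open>u y\<close> costs only
  \<open>O((y - x)\<^sup>2)\<close>, since \<open>F (u z) - F (u y)\<close> and \<open>d\<close> are both \<open>O(y - x)\<close>.\<close>

lemma lyapunov_nonincreasing:
  fixes \<Phi> :: "real ^ 'n ^ 'm"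
  assumes "lam > 0" and u: "forward_solution (lca_field p \<Phi> s lam) u0 u"
    and t: "0 \<le> t" "t \<le> t'"
  shows "lyapunov p \<Phi> s lam (u t') \<le> lyapunov p \<Phi> s lam (u t)"
proof -
  let ?F = "lca_field p \<Phi> s lam"
  let ?V = "\<lambda>t. lyapunov p \<Phi> s lam (u t)"
  let ?a = "\<lambda>t. activation_vec p lam (u t)"
  obtain L where L: "L-lipschitz_on UNIV ?F"
    using lca_field_lipschitz[OF assms(1)] by blast
  have "L \<ge> 0" using L by (rule lipschitz_on_nonneg)
  obtain B where B: "B \<ge> 0" "\<And>x y. \<lbrakk>0 \<le> x; x \<le> y; y \<le> t'\<rbrakk> \<Longrightarrow> norm (u y - u x) \<le> B * (y - x)"
    using forward_solution_lipschitz_on_interval[OF u lipschitz_on_continuous_on[OF L]] by blast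
  show ?thesis
  proof (rule quadratic_increment_imp_le[OF t(2), where C = "L * B * B"])
    fix x y assume xy: "t \<le> x" "x \<le> y" "y \<le> t'"
    show "?V y - ?V x \<le> L * B * B * (y - x)\<^sup>2"
    proof (cases "x < y")
      case True
      define d where "d = ?a y - ?a x"
      obtain z where z: "x < z" "z < y" "(u y - u x) \<bullet> d = (y - x) * (?F (u z) \<bullet> d)"
        using forward_solution_mean_value[OF u _ True, of d] t xy by auto
      have "0 \<le> (u y - u x) \<bullet> d"
        unfolding d_def by (rule activation_vec_mono[OF assms(1)])
      then have pos: "0 \<le> ?F (u z) \<bullet> d" using True z(3) by (simp add: zero_le_mult_iff)
      have "norm (?F (u z) - ?F (u y)) \<le> L * norm (u z - u y)"
        using lipschitz_onD[OF L, of "u z" "u y"] by (simp add: dist_norm)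
      also have "\<dots> \<le> L * (B * (y - x))"
      proof -
        have "norm (u z - u y) \<le> B * (y - z)"
          using B(2)[of z y] z xy t by (simp add: norm_minus_commute)
        also have "\<dots> \<le> B * (y - x)" using B(1) z by (intro mult_left_mono) auto
        finally show ?thesis using \<open>L \<ge> 0\<close> by (rule mult_left_mono)
      qed
      finally have F: "norm (?F (u z) - ?F (u y)) \<le> L * (B * (y - x))" .
      have d: "norm d \<le> B * (y - x)"
        using activation_vec_lipschitz[OF assms(1), of p "u y" "u x"] B(2)[of x y] xy t
        unfolding d_def by linarith
      have "?V y - ?V x \<le> - (?F (u y) \<bullet> d)"
        using objective_subgradient[OF assms(1) activation_vec_feasible[OF assms(1), of p "u x"],
            of \<Phi> s "u y"] by (simp add: d_def lyapunov_def)
      also have "\<dots> \<le> (?F (u z) - ?F (u y)) \<bullet> d" using pos by (simp add: inner_diff_left)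
      also have "\<dots> \<le> norm (?F (u z) - ?F (u y)) * norm d" by (rule norm_cauchy_schwarz)
      also have "\<dots> \<le> (L * (B * (y - x))) * (B * (y - x))"
        using F d by (rule mult_mono) (use \<open>L \<ge> 0\<close> B(1) xy in auto)
      finally show ?thesis by (simp add: power2_eq_square algebra_simps)
    qed (use xy in auto)
  qed
qed

section \<open>The potential relative to a feasible point\<close>

text \<open>Squaring removes the kink at \<open>lam\<close>. The error of the first-order expansion is at most the
  square of the increment, on either side of the kink and across it.\<close>

lemma threshold_square_has_derivative:
  "((\<lambda>x. (threshold lam x)\<^sup>2 / 2) has_real_derivative threshold lam x) (at x)"
proof -
  let ?H = "\<lambda>x. (threshold lam x)\<^sup>2 / 2"
  have quad: "\<bar>?H y - ?H x - threshold lam x * (y - x)\<bar> \<le> (y - x)\<^sup>2" for y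
  proof -
    define a where "a = x - lam"
    define b where "b = y - lam"
    have yx: "y - x = b - a" by (simp add: a_def b_def)
    have ta: "threshold lam x = max a 0" "threshold lam y = max b 0"
      by (auto simp: threshold_def a_def b_def)
    consider "a \<le> 0" "b \<le> 0" | "a \<le> 0" "b > 0" | "a > 0" "b \<le> 0" | "a > 0" "b > 0" by linarith
    then show ?thesis
    proof cases
      case 2
      have "b\<^sup>2 \<le> (b - a)\<^sup>2" using 2 by (intro power_mono) auto
      moreover have "0 \<le> (b - a)\<^sup>2" by simp
      ultimately have "b\<^sup>2 \<le> (b - a)\<^sup>2 * 2" by linarith
      then show ?thesis using 2 unfolding ta yx by simp
    next
      case 3
      have eq: "- (a\<^sup>2 / 2) - a * (b - a) = a\<^sup>2 / 2 - a * b"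
        by (simp add: power2_eq_square algebra_simps)
      have "a * b \<le> 0" using 3 by (simp add: mult_le_0_iff)
      moreover have "(b - a)\<^sup>2 = a\<^sup>2 - 2 * (a * b) + b\<^sup>2" by (simp add: power2_eq_square algebra_simps)
      moreover have "0 \<le> b\<^sup>2" "0 \<le> a\<^sup>2" by auto
      ultimately have "\<bar>- (a\<^sup>2 / 2) - a * (b - a)\<bar> \<le> (b - a)\<^sup>2" unfolding eq by linarith
      then show ?thesis using 3 unfolding ta yx by simp
    next
      case 4
      have eq: "b\<^sup>2 / 2 - a\<^sup>2 / 2 - a * (b - a) = (b - a)\<^sup>2 / 2"
        by (simp add: power2_eq_square field_simps)
      show ?thesis using 4 unfolding ta yx by (simp add: eq)
    qed (auto simp: ta yx)
  qed
  have "(\<lambda>y. (?H y - ?H x) / (y - x) - threshold lam x) \<midarrow>x\<rightarrow> 0"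
  proof (rule Lim_null_comparison[where g = "\<lambda>y. \<bar>y - x\<bar>"])
    show "\<forall>\<^sub>F y in at x. norm ((?H y - ?H x) / (y - x) - threshold lam x) \<le> \<bar>y - x\<bar>"
      unfolding eventually_at_filter
    proof (intro always_eventually allI impI)
      fix y assume "y \<noteq> x"
      then have "(?H y - ?H x) / (y - x) - threshold lam x
          = (?H y - ?H x - threshold lam x * (y - x)) / (y - x)"
        by (simp add: field_simps)
      then show "norm ((?H y - ?H x) / (y - x) - threshold lam x) \<le> \<bar>y - x\<bar>"
        using quad[of y] \<open>y \<noteq> x\<close> by (simp add: divide_le_eq power2_eq_square abs_mult[symmetric])
    qed
    show "(\<lambda>y. \<bar>y - x\<bar>) \<midarrow>x\<rightarrow> 0" by (auto intro!: tendsto_eq_intros)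
  qed
  then show ?thesis unfolding has_field_derivative_iff using LIM_zero_iff by blast
qed

lemma activation_square_has_derivative:
  assumes "lam > 0"
  shows "((\<lambda>x. (activation p lam x)\<^sup>2 / 2) has_real_derivative activation p lam x) (at x)"
proof (cases p)
  case LASSO
  have eq: "(\<lambda>x. (activation p lam x)\<^sup>2 / 2)
      = (\<lambda>x. (threshold lam x)\<^sup>2 / 2 + (threshold lam (- x))\<^sup>2 / 2)"
    using assms by (auto simp: LASSO threshold_def fun_eq_iff power2_eq_square algebra_simps)
  have "((\<lambda>x. (threshold lam (- x))\<^sup>2 / 2) has_real_derivative - threshold lam (- x)) (at x)"
    using DERIV_chain2[OF threshold_square_has_derivative DERIV_minus[OF DERIV_ident]] by simp
  from DERIV_add[OF threshold_square_has_derivative this]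
  show ?thesis unfolding eq by (simp add: LASSO)
next
  case CLASSO
  then show ?thesis using threshold_square_has_derivative by simp
qed

text \<open>Let \<open>h c = \<parallel>c\<parallel>\<^sup>2 / 2 + lam * \<parallel>c\<parallel>\<^sub>1\<close> on the feasible set and \<open>\<infinity>\<close> elsewhere. Its convex conjugate
  is \<open>u \<mapsto> \<parallel>T u\<parallel>\<^sup>2 / 2\<close>, so this is \<open>h\<^sup>* u - u \<bullet> c\<close>, which differs from the Bregman distance of
  mirror descent by the constant \<open>h c\<close>.\<close>

definition potential :: "problem \<Rightarrow> real \<Rightarrow> real ^ 'n \<Rightarrow> real ^ 'n \<Rightarrow> real" where
  "potential p lam c u = (\<Sum>n\<in>UNIV. (activation p lam (u $ n))\<^sup>2 / 2 - u $ n * c $ n)"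

text \<open>The Fenchel inequality \<open>u \<bullet> c \<le> h c + h\<^sup>* u\<close>. In each coordinate it follows from the proximal
  inequality at \<open>c\<close> and at \<open>2 * a\<close>, the latter giving \<open>(x - a) * a \<le> lam * \<bar>a\<bar>\<close>.\<close>

lemma potential_lower_bound:
  assumes "lam > 0" and "c \<in> feasible p"
  shows "- ((norm c)\<^sup>2 / 2 + lam * l1_norm c) \<le> potential p lam c u"
proof -
  have scalar: "- (c $ n * c $ n / 2 + lam * \<bar>c $ n\<bar>) \<le> (activation p lam x)\<^sup>2 / 2 - x * c $ n" for n x
  proof -
    define a where "a = activation p lam x"
    have "(x - a) * (c $ n - a) \<le> lam * \<bar>c $ n\<bar> - lam * \<bar>a\<bar>"
      unfolding a_def using assms by (intro activation_prox) auto
    moreover have "(x - a) * (2 * a - a) \<le> lam * \<bar>2 * a\<bar> - lam * \<bar>a\<bar>"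
      unfolding a_def using assms by (intro activation_prox) (auto simp: threshold_def)
    moreover have "0 \<le> (a - c $ n)\<^sup>2" by simp
    ultimately show ?thesis
      unfolding a_def[symmetric] by (simp add: power2_eq_square algebra_simps abs_mult)
  qed
  have "- ((norm c)\<^sup>2 / 2 + lam * l1_norm c) = (\<Sum>n\<in>UNIV. - (c $ n * c $ n / 2 + lam * \<bar>c $ n\<bar>))"
    by (simp add: power2_norm_eq_inner inner_vec_def l1_norm_def sum.distrib sum_negf
        sum_distrib_left sum_divide_distrib sum_subtractf)
  also have "\<dots> \<le> potential p lam c u"
    unfolding potential_def by (rule sum_mono) (rule scalar)
  finally show ?thesis .
qed

lemma potential_has_derivative:
  assumes "lam > 0" and "(u has_vector_derivative v) (at t within S)"
  shows "((\<lambda>t. potential p lam c (u t)) has_real_derivative v \<bullet> (activation_vec p lam (u t) - c))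
    (at t within S)"
proof -
  have comp: "((\<lambda>t. u t $ n) has_real_derivative v $ n) (at t within S)" for n
    using bounded_linear.has_vector_derivative[OF bounded_linear_vec_nth assms(2)]
    by (simp add: has_real_derivative_iff_has_vector_derivative)
  have "((\<lambda>t. (activation p lam (u t $ n))\<^sup>2 / 2 - u t $ n * c $ n) has_real_derivative
      v $ n * (activation p lam (u t $ n) - c $ n)) (at t within S)" for n
    using DERIV_diff[OF DERIV_chain2[OF activation_square_has_derivative[OF assms(1)] comp]
        DERIV_cmult_right[OF comp]]
    by (simp add: algebra_simps)
  then show ?thesis
    unfolding potential_def inner_vec_def
    by (auto intro!: DERIV_sum simp: activation_vec_def)
qed

text \<open>The derivative of the potential at time \<open>r \<le> t\<close> is at most \<open>E c - V (u r) \<le> E c - V (u t)\<close>, a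
  constant. Hence adding \<open>r * (V (u t) - E c)\<close> to the potential makes a nonincreasing function
  of \<open>r\<close> on \<open>[0, t]\<close>.\<close>

lemma lyapunov_gap_bound:
  fixes \<Phi> :: "real ^ 'n ^ 'm"
  assumes "lam > 0" and u: "forward_solution (lca_field p \<Phi> s lam) u0 u"
    and c: "c \<in> feasible p" and t: "0 \<le> t"
  shows "t * (lyapunov p \<Phi> s lam (u t) - objective \<Phi> s lam c)
    \<le> potential p lam c u0 + (norm c)\<^sup>2 / 2 + lam * l1_norm c"
proof -
  define D where "D = lyapunov p \<Phi> s lam (u t) - objective \<Phi> s lam c"
  let ?W = "\<lambda>r. potential p lam c (u r) + r * D"
  let ?W' = "\<lambda>r. lca_field p \<Phi> s lam (u r) \<bullet> (activation_vec p lam (u r) - c) + D"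
  have dW: "(?W has_real_derivative ?W' r) (at r within {0..})" if "0 \<le> r" for r
  proof -
    have "(u has_vector_derivative lca_field p \<Phi> s lam (u r)) (at r within {0..})"
      using u that by (simp add: forward_solution_def)
    from potential_has_derivative[OF assms(1) this] show ?thesis
      by (auto intro!: derivative_eq_intros)
  qed
  have "?W t \<le> ?W 0"
  proof (rule DERIV_nonpos_imp_decreasing_open[OF t])
    fix r assume r: "0 < r" "r < t"
    have "at r within {0..} = at r"
      using r(1) by (intro at_within_interior) simp
    then have "(?W has_real_derivative ?W' r) (at r)"
      using dW[of r] r(1) by simp
    moreover have "?W' r \<le> 0"
      using objective_subgradient[OF assms(1) c, of \<Phi> s "u r"]
        lyapunov_nonincreasing[OF assms(1) u, of r t] r
      by (simp add: D_def)
    ultimately show "\<exists>y. (?W has_real_derivative y) (at r) \<and> y \<le> 0" by blast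
  next
    show "continuous_on {0..t} ?W"
      by (rule DERIV_continuous_on, rule DERIV_subset[OF dW]) auto
  qed
  moreover have "u 0 = u0" using u by (simp add: forward_solution_def)
  ultimately show ?thesis
    using potential_lower_bound[OF assms(1) c, of "u t"] by (simp add: D_def)
qed

section \<open>Convergence to the optimal value\<close>

theorem theorem7:
  fixes \<Phi> :: "real ^ 'n ^ 'm" and s :: "real ^ 'm" and lam :: real
    and p :: problem and a_star u0 :: "real ^ 'n"
  assumes "lam > 0"
    and "\<And>n. norm (column n \<Phi>) = 1"
    and "a_star \<in> optimal_solutions p \<Phi> s lam"
  shows "((\<lambda>t. lyapunov p \<Phi> s lam (lca_flow p \<Phi> s lam t u0)) \<longlongrightarrow> objective \<Phi> s lam a_star) at_top"
proof -
  let ?V = "\<lambda>t. lyapunov p \<Phi> s lam (lca_flow p \<Phi> s lam t u0)"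
  let ?E = "objective \<Phi> s lam a_star"
  define K where "K = potential p lam a_star u0 + (norm a_star)\<^sup>2 / 2 + lam * l1_norm a_star"
  have opt: "a_star \<in> feasible p" "\<And>a. a \<in> feasible p \<Longrightarrow> ?E \<le> objective \<Phi> s lam a"
    using assms(3) by (auto simp: optimal_solutions_def)
  have lower: "?E \<le> ?V t" for t
    unfolding lyapunov_def by (rule opt(2)[OF activation_vec_feasible[OF assms(1)]])
  have upper: "?V t \<le> ?E + K / t" if "t > 0" for t
    using lyapunov_gap_bound[OF assms(1) lca_flow_solution[OF assms(1)] opt(1), of t \<Phi> s u0] that
    by (simp add: K_def field_simps)
  have "((\<lambda>t. ?E + K / t) \<longlongrightarrow> ?E + 0) at_top"
    by (intro tendsto_intros tendsto_divide_0[OF tendsto_const] filterlim_at_top_imp_at_infinity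
        filterlim_ident)
  then have lim: "((\<lambda>t. ?E + K / t) \<longlongrightarrow> ?E) at_top" by simp
  show ?thesis
  proof (rule tendsto_sandwich[OF _ _ tendsto_const lim])
    show "\<forall>\<^sub>F t in at_top. ?E \<le> ?V t" using lower by (rule always_eventually[OF allI])
    show "\<forall>\<^sub>F t in at_top. ?V t \<le> ?E + K / t"
      using eventually_gt_at_top[of 0] by eventually_elim (rule upper)
  qed
qed

end
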